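(* Let $\rho\in[0,1]$ and let $\sigma:\mathbb{Z}\to\mathbb{C}$ satisfy the $\rho$-condition: there is $C>0$ such that $|\sigma(\xi)|\le C|\xi|^{-\rho}$ for all $\xi\in\mathbb{Z}\setminus\{0\}$. Let $r,s\in\mathbb{R}$. (i) If $r+\frac12-\rho<s\le 1$, $0<p\le\infty$ and $0<q<\infty$, then the Fourier multiplier $\mathrm{Op}(\sigma)$ is bounded from $B^{s}_{\infty,\infty}(\mathbb{T})$ into $B^{r}_{p,q}(\mathbb{T})$. (ii) If $r+\frac12-\rho\le s\le 1$ and $0<p\le\infty$, then $\mathrm{Op}(\sigma)$ is bounded from $B^{s}_{\infty,\infty}(\mathbb{T})$ into $B^{r}_{p,\infty}(\mathbb{T})$.
   Context: $\mathbb{T}=[0,2\pi)$ is the one-dimensional torus with normalized Haar measure $dx$; $\widehat f(\xi)=(\mathscr{F}f)(\xi)=\int_{\mathbb{T}}e^{-ix\xi}f(x)\,dx$ for $\xi\in\mathbb{Z}$, so that $f(x)=\sum_{\xi\in\mathbb{Z}}e^{ix\xi}\widehat f(\xi)$ for $f\in C^\infty(\mathbb{T})$. For $\sigma:\mathbb{Z}\to\mathbb{C}$, the Fourier multiplier is $\mathrm{Op}(\sigma)f(x)=\sum_{\xi\in\mathbb{Z}}e^{ix\xi}\sigma(\xi)\widehat f(\xi)$. Besov spaces: for $r\in\mathbb{R}$, $0<p\le\infty$, $0<q<\infty$, $$\|f\|_{B^r_{p,q}}=\Big(\sum_{m=0}^\infty 2^{mrq}\Big\|\sum_{2^m\le|\xi|<2^{m+1}}e^{ix\xi}\widehat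 f(\xi)\Big\|_{L^p(\mathbb{T})}^q\Big)^{1/q},$$ $$\|f\|_{B^r_{p,\infty}}=\sup_{m\ge 0}2^{mr}\Big\|\sum_{2^m\le|\xi|<2^{m+1}}e^{ix\xi}\widehat f(\xi)\Big\|_{L^p(\mathbb{T})}.$$ For $0<r<1$ the paper identifies $B^r_{\infty,\infty}(\mathbb{T})$ with the Hölder space $\Lambda^r(\mathbb{T})$ with norm $\|f\|_{\Lambda^r}=\sup_{x,\,y\neq 0}\frac{|f(x-y)-f(x)|}{|y|^r}+\sup_x|f(x)|$. Bounded from $X$ into $Y$ means: there is $C>0$ with $\|\mathrm{Op}(\sigma)f\|_Y\le C\|f\|_X$ for all $f\in C^\infty(\mathbb{T})$. *)

theory Defs
  imports "HOL-Analysis.Analysis" "HOL-Probability.Essential_Supremum"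
begin

text \<open>Functions on the torus are represented by functions on the real line, restricted to
  [0, 2 pi) for integration and assumed to be 2 pi-periodic where smoothness matters.\<close>

definition torus :: "real measure" where
  "torus = uniform_measure lborel {0..<2 * pi}"

definition smooth_torus :: "(real \<Rightarrow> complex) set" where
  "smooth_torus = {f. (\<forall>x. f (x + 2 * pi) = f x) \<and>
     (\<forall>n x. ((\<lambda>g t. vector_derivative g (at t)) ^^ n) f differentiable at x)}"

definition fourier_coeff :: "(real \<Rightarrow> complex) \<Rightarrow> int \<Rightarrow> complex" where
  "fourier_coeff f \<xi> = (LINT x|torus. cis (- (x * of_int \<xi>)) * f x)"

definition fourier_multiplier :: "(int \<Rightarrow> complex) \<Rightarrow> (real \<Rightarrow> complex) \<Rightarrow> real \<Rightarrow> complex" where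
  "fourier_multiplier \<sigma> f x = (\<Sum>\<^sub>\<infinity>\<xi>\<in>UNIV. cis (x * of_int \<xi>) * \<sigma> \<xi> * fourier_coeff f \<xi>)"

definition rho_condition :: "real \<Rightarrow> (int \<Rightarrow> complex) \<Rightarrow> bool" where
  "rho_condition \<rho> \<sigma> \<longleftrightarrow>
     (\<exists>C>0. \<forall>\<xi>. \<xi> \<noteq> 0 \<longrightarrow> cmod (\<sigma> \<xi>) \<le> C * \<bar>of_int \<xi>\<bar> powr (- \<rho>))"

text \<open>Real powers on the extended nonnegative reals, only used with a positive exponent.\<close>

definition ennreal_powr :: "ennreal \<Rightarrow> real \<Rightarrow> ennreal" where
  "ennreal_powr x a = (if x = \<infinity> then \<infinity> else ennreal (enn2real x powr a))"

text \<open>The integrability exponents p and q range over the extended positive half-line, with the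
  value infinity treated separately. For p below 1 the functional is only a quasi-norm.\<close>

definition Lp_norm :: "ennreal \<Rightarrow> (real \<Rightarrow> complex) \<Rightarrow> ennreal" where
  "Lp_norm p f =
     (if p = \<infinity> then esssup torus (\<lambda>x. ennreal (cmod (f x)))
      else ennreal_powr (\<integral>\<^sup>+ x. ennreal (cmod (f x) powr enn2real p) \<partial>torus) (1 / enn2real p))"

definition dyadic_block :: "nat \<Rightarrow> (real \<Rightarrow> complex) \<Rightarrow> real \<Rightarrow> complex" where
  "dyadic_block m f x =
     (\<Sum>\<xi> | 2 ^ m \<le> \<bar>\<xi>\<bar> \<and> \<bar>\<xi>\<bar> < 2 ^ (m + 1). cis (x * of_int \<xi>) * fourier_coeff f \<xi>)"

text \<open>As the dyadic blocks start at frequency 1, the zeroth Fourier coefficient does not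
  contribute.\<close>

definition besov_norm :: "real \<Rightarrow> ennreal \<Rightarrow> ennreal \<Rightarrow> (real \<Rightarrow> complex) \<Rightarrow> ennreal" where
  "besov_norm r p q f =
     (if q = \<infinity> then (SUP m. ennreal (2 powr (real m * r)) * Lp_norm p (dyadic_block m f))
      else ennreal_powr
        (\<Sum>m. ennreal (2 powr (real m * r * enn2real q)) *
              ennreal_powr (Lp_norm p (dyadic_block m f)) (enn2real q))
        (1 / enn2real q))"

definition bounded_from_into ::
  "((real \<Rightarrow> complex) \<Rightarrow> ennreal) \<Rightarrow> ((real \<Rightarrow> complex) \<Rightarrow> ennreal) \<Rightarrow>
   ((real \<Rightarrow> complex) \<Rightarrow> (real \<Rightarrow> complex)) \<Rightarrow> bool" where
  "bounded_from_into normX normY T \<longleftrightarrow>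
     (\<exists>C>0::real. \<forall>f\<in>smooth_torus. normY (T f) \<le> ennreal C * normX f)"

end

theory Submission
  imports Defs "HOL-Probability.Probability_Measure"
begin

text \<open>The multiplier is estimated one dyadic block at a time, from \<open>L\<^sup>\<infinity>\<close> to \<open>L\<^sup>p\<close>. Write
  \<open>D\<^sub>m\<close> for the block \<open>2 ^ m \<le> \<bar>\<xi>\<bar> < 2 ^ (m + 1)\<close>. As the torus has total mass one, the
  \<open>L\<^sup>p\<close> norm of the block of \<open>Op(\<sigma>) f\<close> is at most its supremum norm, hence at most the sum of
  \<open>\<bar>\<sigma>(\<xi>)\<bar> \<bar>f^(\<xi>)\<bar>\<close> over \<open>D\<^sub>m\<close>, where \<open>f^\<close> denotes the Fourier coefficients. Here \<open>\<bar>\<sigma>(\<xi>)\<bar>\<close> is at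
  most \<open>C 2 ^ (- m \<rho>)\<close>, because \<open>\<rho> \<ge> 0\<close>. Since \<open>D\<^sub>m\<close> has \<open>2 * 2 ^ m\<close> elements, the
  Cauchy-Schwarz inequality bounds the sum of the \<open>\<bar>f^(\<xi>)\<bar>\<close> by \<open>sqrt (2 * 2 ^ m)\<close> times their
  \<open>l\<^sup>2\<close> norm. By Parseval's identity the latter is the \<open>L\<^sup>2\<close> norm of the block of \<open>f\<close>, which is at
  most its \<open>L\<^sup>\<infinity>\<close> norm. The result is
  \<open>Lp_norm_dyadic_block_multiplier_le\<close>: on \<open>D\<^sub>m\<close> the operator costs a factor
  \<open>sqrt 2 * C * 2 ^ (m (1/2 - \<rho>))\<close>. The loss of half a derivative in the theorem is the exponent
  \<open>1/2\<close> from Cauchy-Schwarz.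

  The \<open>L\<^sup>\<infinity>\<close> norm of the block of \<open>f\<close> is at most \<open>2 ^ (- m s)\<close> times the Besov norm of \<open>f\<close>, so the
  weighted norm of the block of \<open>Op(\<sigma>) f\<close> is at most a constant times \<open>2 ^ (m (r + 1/2 - \<rho> - s))\<close>
  times that norm. If the exponent is nonpositive, this is bounded in \<open>m\<close>, which gives the case
  \<open>q = \<infinity>\<close>; if it is negative, the \<open>q\<close>-th powers form a convergent geometric series, which gives the
  case \<open>q < \<infinity>\<close>.\<close>

section \<open>Characters on the torus\<close>

interpretation torus: prob_space torus
  unfolding torus_def by (rule prob_space_uniform_measure) simp_all

lemma sets_torus [measurable_cong, simp]: "sets torus = sets borel"
  by (simp add: torus_def)

lemma cis_measurable [measurable]: "(cis :: real \<Rightarrow> complex) \<in> borel_measurable borel"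
  by (intro borel_measurable_continuous_onI continuous_intros)

lemma character_measurable [measurable]: "(\<lambda>x::real. cis (x * a)) \<in> borel_measurable borel"
  by measurable

lemma integrable_character: "integrable torus (\<lambda>x::real. cis (x * a))"
  by (rule torus.integrable_const_bound[where B = 1]) auto

lemma character_diff: "cis (x * of_int (j - k)) = cis (x * of_int j) * cis (- (x * of_int k))"
  by (simp add: cis_mult right_diff_distrib)

lemma integral_torus:
  assumes [measurable]: "f \<in> borel_measurable borel"
  shows "(LINT x|torus. f x :: complex) = (LINT x:{0..2 * pi}|lborel. f x) / complex_of_real (2 * pi)"
proof -
  have *: "indicator {0..<2 * pi} x / ennreal (2 * pi) = ennreal (indicator {0..<2 * pi} x / (2 * pi))"
    for x :: real
    by (auto simp: indicator_def divide_ennreal_def inverse_ennreal) (simp add: inverse_eq_divide)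
  have "(LINT x|torus. f x) = (LINT x|lborel. (indicator {0..<2 * pi} x / (2 * pi)) *\<^sub>R f x)"
    unfolding torus_def uniform_measure_def
    by (simp add: *) (subst integral_density; simp)
  also have "\<dots> = (LINT x:{0..<2 * pi}|lborel. f x) / complex_of_real (2 * pi)"
    unfolding set_lebesgue_integral_def
    by (subst integral_divide_zero[symmetric])
       (auto intro!: Bochner_Integration.integral_cong simp: scaleR_conv_of_real)
  also have "(LINT x:{0..<2 * pi}|lborel. f x) = (LINT x:{0..2 * pi}|lborel. f x)"
    by (rule set_integral_discrete_difference[where X = "{2 * pi}"]) auto
  finally show ?thesis .
qed

lemma integral_character:
  "(LINT x|torus. cis (x * of_int n)) = (if n = 0 then 1 else 0)"
proof (cases "n = 0")
  case False
  have "(LINT x:{0..2 * pi}|lborel. cis (x * of_int n))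
      = cis (2 * pi * of_int n) / (\<i> * of_int n) - cis (0 * of_int n) / (\<i> * of_int n)"
    unfolding set_lebesgue_integral_def
  proof (rule integral_FTC_atLeastAtMost)
    fix x :: real
    show "((\<lambda>x. cis (x * of_int n) / (\<i> * of_int n)) has_vector_derivative cis (x * of_int n))
        (at x within {0..2 * pi})"
      unfolding has_vector_derivative_def using False
      by (auto intro!: derivative_eq_intros simp: fun_eq_iff scaleR_conv_of_real field_simps)
  qed (auto intro!: continuous_intros)
  also have "\<dots> = 0"
    by (simp add: cis_multiple_2pi)
  finally show ?thesis
    using False by (simp add: integral_torus)
qed (simp add: torus.prob_space)

text \<open>Parseval's identity: expanding the square leaves only the diagonal terms, as distinct characters
  are orthogonal.\<close>
lemma integral_norm_trig_polynomial_squared: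
  assumes "finite S"
  shows "(LINT x|torus. (cmod (\<Sum>k\<in>S. cis (x * of_int k) * c k))\<^sup>2) = (\<Sum>k\<in>S. (cmod (c k))\<^sup>2)"
proof -
  have "complex_of_real (LINT x|torus. (cmod (\<Sum>k\<in>S. cis (x * of_int k) * c k))\<^sup>2)
      = (LINT x|torus. (\<Sum>j\<in>S. \<Sum>k\<in>S. cis (x * of_int (j - k)) * (c j * cnj (c k))))"
    unfolding integral_complex_of_real[symmetric]
    by (intro Bochner_Integration.integral_cong refl, subst complex_norm_square)
       (simp add: sum_product cis_cnj character_diff mult_ac del: of_int_diff)
  also have "\<dots> = (\<Sum>j\<in>S. \<Sum>k\<in>S. (if j - k = 0 then 1 else 0) * (c j * cnj (c k)))"
    by (simp add: integrable_character integral_character del: of_int_diff)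
  also have "\<dots> = complex_of_real (\<Sum>k\<in>S. (cmod (c k))\<^sup>2)"
    using assms unfolding of_real_sum complex_norm_square
    by (simp add: if_distrib[of "\<lambda>z. z * _"] sum.delta cong: if_cong)
  finally show ?thesis
    by (simp only: of_real_eq_iff)
qed

text \<open>The series is dominated by a constant, and the measure is finite, so it may be integrated term by
  term against a character.\<close>
lemma fourier_coeff_absolutely_convergent_series:
  assumes "(\<lambda>\<xi>. cmod (a \<xi>)) summable_on UNIV"
  shows "fourier_coeff (\<lambda>x. \<Sum>\<^sub>\<infinity>\<xi>\<in>UNIV. cis (x * of_int \<xi>) * a \<xi>) k = a k"
proof -
  \<comment> \<open>Integration term by term is available for sequences, so the frequencies are enumerated.\<close>
  define d where "d = int_decode"
  have d: "bij d"
    unfolding d_def by (rule bij_int_decode)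
  have summ: "summable (\<lambda>n. cmod (a (d n)))"
    using assms summable_on_reindex_bij_betw[OF d, of "\<lambda>\<xi>. cmod (a \<xi>)"]
    by (simp add: summable_on_imp_summable)
  have series: "(\<Sum>\<^sub>\<infinity>\<xi>\<in>UNIV. cis (x * of_int \<xi>) * a \<xi>) = (\<Sum>n. cis (x * of_int (d n)) * a (d n))" for x
  proof -
    have "(\<Sum>\<^sub>\<infinity>\<xi>\<in>UNIV. cis (x * of_int \<xi>) * a \<xi>) = (\<Sum>\<^sub>\<infinity>n. cis (x * of_int (d n)) * a (d n))"
      using infsum_reindex_bij_betw[OF d, of "\<lambda>\<xi>. cis (x * of_int \<xi>) * a \<xi>"] by simp
    also have "\<dots> = (\<Sum>n. cis (x * of_int (d n)) * a (d n))"
      using summ by (intro infsumI norm_summable_imp_has_sum)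
        (auto simp: norm_mult intro!: summable_sums summable_norm_cancel[where f = "\<lambda>n. _ n * _ n"])
    finally show ?thesis .
  qed
  have "fourier_coeff (\<lambda>x. \<Sum>\<^sub>\<infinity>\<xi>\<in>UNIV. cis (x * of_int \<xi>) * a \<xi>) k
      = (LINT x|torus. (\<Sum>n. cis (x * of_int (d n - k)) * a (d n)))"
    unfolding fourier_coeff_def series
    by (intro Bochner_Integration.integral_cong refl, subst suminf_mult[symmetric])
       (use summ in \<open>auto simp: norm_mult character_diff mult_ac simp del: of_int_diff
          intro!: summable_norm_cancel[where f = "\<lambda>n. _ n * _ n"]\<close>)
  also have "\<dots> = (\<Sum>n. LINT x|torus. cis (x * of_int (d n - k)) * a (d n))"
    using summ
    by (intro integral_suminf integrable_mult_left integrable_character)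
       (auto simp: norm_mult torus.prob_space)
  also have "\<dots> = (\<Sum>n. if n = inv d k then a k else 0)"
    by (intro suminf_cong) (use d in \<open>auto simp: integral_character integrable_character
       bij_inv_eq_iff bij_is_surj surj_f_inv_f simp del: of_int_diff\<close>)
  also have "\<dots> = a k"
    using sums_single[of "inv d k" "\<lambda>_. a k"] by (simp add: sums_iff)
  finally show ?thesis .
qed

text \<open>Equality holds when the series defining the multiplier converges absolutely. For complex terms,
  unordered summability is the same as absolute summability, and characters have modulus one, so the
  series otherwise converges at no point. Its value is then zero everywhere by the convention for
  divergent sums. The inequality covers both cases.\<close>
lemma norm_fourier_coeff_multiplier_le:
  "cmod (fourier_coeff (fourier_multiplier \<sigma> f) k) \<le> cmod (\<sigma> k) * cmod (fourier_coeff f k)"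
proof -
  define a where "a \<xi> = \<sigma> \<xi> * fourier_coeff f \<xi>" for \<xi>
  have mult: "fourier_multiplier \<sigma> f = (\<lambda>x. \<Sum>\<^sub>\<infinity>\<xi>\<in>UNIV. cis (x * of_int \<xi>) * a \<xi>)"
    by (simp add: fun_eq_iff fourier_multiplier_def a_def mult.assoc)
  show ?thesis
  proof (cases "(\<lambda>\<xi>. cmod (a \<xi>)) summable_on UNIV")
    case True
    then show ?thesis
      unfolding mult by (simp add: fourier_coeff_absolutely_convergent_series a_def norm_mult)
  next
    case False
    have "\<not> (\<lambda>\<xi>. cis (x * of_int \<xi>) * a \<xi>) summable_on UNIV" for x
      using False
      by (subst summable_on_iff_abs_summable_on_complex) (simp add: norm_mult)
    then have "fourier_multiplier \<sigma> f = (\<lambda>x. 0)"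
      unfolding mult by (simp add: infsum_not_exists)
    then show ?thesis
      by (simp add: fourier_coeff_def)
  qed
qed

section \<open>Integral norms\<close>

lemma ennreal_powr_ennreal [simp]: "0 \<le> x \<Longrightarrow> ennreal_powr (ennreal x) a = ennreal (x powr a)"
  by (simp add: ennreal_powr_def)

lemma ennreal_powr_mono:
  assumes "x \<le> y" "0 \<le> a"
  shows "ennreal_powr x a \<le> ennreal_powr y a"
proof (cases "y = \<infinity>")
  case False
  then have "x < \<infinity>" "y < \<infinity>"
    using assms by (auto simp: less_top intro: le_less_trans)
  then show ?thesis
    using assms by (auto simp: ennreal_powr_def intro!: ennreal_leI powr_mono2 enn2real_mono)
qed (simp add: ennreal_powr_def)

lemma Lp_norm_le_of_bounded:
  assumes [measurable]: "f \<in> borel_measurable borel" and "0 < p" "0 \<le> B" "\<And>x. cmod (f x) \<le> B"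
  shows "Lp_norm p f \<le> ennreal B"
proof (cases "p = \<infinity>")
  case True
  then show ?thesis
    using assms by (auto simp: Lp_norm_def intro!: esssup_I ennreal_leI)
next
  case False
  define p' where "p' = enn2real p"
  have p': "0 < p'"
    using False assms by (simp add: p'_def enn2real_positive_iff less_top)
  have "(\<integral>\<^sup>+ x. ennreal (cmod (f x) powr p') \<partial>torus) \<le> (\<integral>\<^sup>+ x. ennreal (B powr p') \<partial>torus)"
    using assms p' by (intro nn_integral_mono ennreal_leI powr_mono2) auto
  also have "\<dots> = ennreal (B powr p')"
    by (simp add: torus.emeasure_space_1)
  finally have "Lp_norm p f \<le> ennreal_powr (ennreal (B powr p')) (1 / p')"
    using False p' unfolding Lp_norm_def p'_def[symmetric] by (simp add: ennreal_powr_mono del: ennreal_powr_ennreal)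
  also have "\<dots> = ennreal B"
    using p' assms by (simp add: powr_powr)
  finally show ?thesis .
qed

abbreviation dyadic_frequencies :: "nat \<Rightarrow> int set" where
  "dyadic_frequencies m \<equiv> {\<xi>. 2 ^ m \<le> \<bar>\<xi>\<bar> \<and> \<bar>\<xi>\<bar> < 2 ^ (m + 1)}"

lemma dyadic_frequencies_eq:
  "dyadic_frequencies m = {2 ^ m..<2 ^ (m + 1)} \<union> uminus ` {2 ^ m..<2 ^ (m + 1)}"
proof -
  have "\<xi> \<in> {2 ^ m..<2 ^ (m + 1)} \<union> uminus ` {2 ^ m..<2 ^ (m + 1)}"
    if "\<xi> \<in> dyadic_frequencies m" for \<xi>
    using that by (cases "\<xi> < 0") (auto intro!: image_eqI[of _ _ "- \<xi>"])
  moreover have "(0 :: int) < 2 ^ m"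
    by simp
  then have "{2 ^ m..<2 ^ (m + 1)} \<union> uminus ` {2 ^ m..<2 ^ (m + 1)} \<subseteq> dyadic_frequencies m"
    by auto
  ultimately show ?thesis
    by blast
qed

lemma finite_dyadic_frequencies [simp]: "finite (dyadic_frequencies m)"
  unfolding dyadic_frequencies_eq by (intro finite_UnI finite_imageI finite_atLeastLessThan_int)

lemma card_dyadic_frequencies_le: "real (card (dyadic_frequencies m)) \<le> 2 * 2 ^ m"
proof -
  have c: "card {2 ^ m..<2 ^ (m + 1) :: int} = 2 ^ m"
    by (simp add: nat_power_eq)
  have "card (dyadic_frequencies m) \<le> 2 ^ m + card (uminus ` {2 ^ m..<2 ^ (m + 1) :: int})"
    unfolding dyadic_frequencies_eq c[symmetric] by (rule card_Un_le)
  also have "\<dots> = 2 * 2 ^ m"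
    by (subst card_image) (auto simp: c)
  finally have "real (card (dyadic_frequencies m)) \<le> real (2 * 2 ^ m)"
    by (simp only: of_nat_le_iff)
  then show ?thesis
    by simp
qed

lemma dyadic_block_measurable [measurable]: "dyadic_block m f \<in> borel_measurable borel"
  unfolding dyadic_block_def by measurable

text \<open>By Parseval's identity the left-hand side is the \<open>L\<^sup>2\<close> norm of the block, and the \<open>L\<^sup>2\<close> norm is
  at most the \<open>L\<^sup>\<infinity>\<close> norm on a probability space.\<close>
lemma l2_dyadic_coeffs_le_Linfinity:
  "ennreal (sqrt (\<Sum>\<xi>\<in>dyadic_frequencies m. (cmod (fourier_coeff f \<xi>))\<^sup>2))
    \<le> Lp_norm \<infinity> (dyadic_block m f)"
proof (cases "Lp_norm \<infinity> (dyadic_block m f)")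
  case (real B)
  have "AE x in torus. ennreal (cmod (dyadic_block m f x)) \<le> ennreal B"
    using esssup_AE[of "\<lambda>x. ennreal (cmod (dyadic_block m f x))" torus] real
    by (simp add: Lp_norm_def)
  then have ae: "AE x in torus. (cmod (dyadic_block m f x))\<^sup>2 \<le> B\<^sup>2"
    using real by (auto simp: ennreal_le_iff intro!: power_mono elim!: eventually_mono)
  have "integrable torus (\<lambda>x. (cmod (dyadic_block m f x))\<^sup>2)"
    using ae by (intro torus.integrable_const_bound[where B = "B\<^sup>2"]) auto
  then have "(LINT x|torus. (cmod (dyadic_block m f x))\<^sup>2) \<le> B\<^sup>2"
    using ae by (rule torus.integral_le_const)
  then have "(\<Sum>\<xi>\<in>dyadic_frequencies m. (cmod (fourier_coeff f \<xi>))\<^sup>2) \<le> B\<^sup>2"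
    unfolding dyadic_block_def
    by (subst (asm) integral_norm_trig_polynomial_squared[OF finite_dyadic_frequencies])
  then show ?thesis
    unfolding real(2) using real(1) by (intro ennreal_leI real_le_lsqrt) (auto intro: sum_nonneg)
qed simp

section \<open>The multiplier on one dyadic block\<close>

text \<open>The factor \<open>2 powr (- real m * \<rho>)\<close> comes from the symbol, the factor
  \<open>sqrt (2 * 2 ^ m)\<close> from the Cauchy-Schwarz inequality over the \<open>2 * 2 ^ m\<close> frequencies of the block.\<close>
lemma Lp_norm_dyadic_block_multiplier_le:
  assumes "0 \<le> \<rho>" "0 < p" "0 \<le> C"
    and \<sigma>: "\<And>\<xi>. \<xi> \<noteq> 0 \<Longrightarrow> cmod (\<sigma> \<xi>) \<le> C * \<bar>of_int \<xi>\<bar> powr (- \<rho>)"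
  shows "Lp_norm p (dyadic_block m (fourier_multiplier \<sigma> f))
    \<le> ennreal (sqrt 2 * C * 2 powr (real m * (1/2 - \<rho>))) * Lp_norm \<infinity> (dyadic_block m f)"
proof -
  let ?D = "dyadic_frequencies m" and ?c = "\<lambda>\<xi>. cmod (fourier_coeff f \<xi>)"
  define L where "L = sqrt (\<Sum>\<xi>\<in>?D. (?c \<xi>)\<^sup>2)"
  define M where "M = C * 2 powr (- real m * \<rho>)"
  have "0 \<le> L" "0 \<le> M"
    using assms by (auto simp: L_def M_def intro!: sum_nonneg)
  have M: "cmod (\<sigma> \<xi>) \<le> M" if "\<xi> \<in> ?D" for \<xi>
  proof -
    have *: "(2::real) powr real m \<le> \<bar>of_int \<xi>\<bar>"
      using that by (simp add: powr_realpow) (metis of_int_abs of_int_le_iff of_int_numeral of_int_power)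
    have "\<xi> \<noteq> 0"
      using that by auto
    moreover have "\<bar>of_int \<xi>\<bar> powr (- \<rho>) \<le> (2 powr real m) powr (- \<rho>)"
      using * assms by (intro powr_mono2') auto
    ultimately show ?thesis
      using \<sigma>[of \<xi>] assms by (fastforce simp: M_def powr_powr intro: order_trans mult_left_mono)
  qed
  have "cmod (dyadic_block m (fourier_multiplier \<sigma> f) x) \<le> sqrt 2 * C * 2 powr (real m * (1/2 - \<rho>)) * L"
    for x
  proof -
    have "cmod (dyadic_block m (fourier_multiplier \<sigma> f) x) \<le> (\<Sum>\<xi>\<in>?D. M * ?c \<xi>)"
      unfolding dyadic_block_def
      by (rule sum_norm_le)
         (auto simp: norm_mult intro!: order_trans[OF norm_fourier_coeff_multiplier_le] mult_right_mono M)
    also have "\<dots> = M * (\<Sum>\<xi>\<in>?D. \<bar>1\<bar> * \<bar>?c \<xi>\<bar>)"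
      by (simp add: sum_distrib_left)
    also have "\<dots> \<le> M * (L2_set (\<lambda>_. 1) ?D * L2_set ?c ?D)"
      using \<open>0 \<le> M\<close> by (intro mult_left_mono L2_set_mult_ineq)
    also have "\<dots> = M * (sqrt (card ?D) * L)"
      by (simp add: L2_set_def L_def)
    also have "\<dots> \<le> M * (sqrt (2 * 2 ^ m) * L)"
      using \<open>0 \<le> M\<close> \<open>0 \<le> L\<close> card_dyadic_frequencies_le[of m]
      by (intro mult_left_mono mult_right_mono real_sqrt_le_mono) auto
    also have "\<dots> = sqrt 2 * C * 2 powr (real m * (1/2 - \<rho>)) * L"
    proof -
      have "sqrt (2 ^ m) = 2 powr (real m * (1/2))"
        by (simp add: powr_half_sqrt[symmetric] powr_realpow[symmetric] powr_powr)
      moreover have "2 powr (- real m * \<rho>) * 2 powr (real m * (1/2)) = 2 powr (real m * (1/2 - \<rho>))"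
        by (simp add: powr_add[symmetric] algebra_simps)
      ultimately show ?thesis
        by (simp add: M_def real_sqrt_mult)
    qed
    finally show ?thesis .
  qed
  then have "Lp_norm p (dyadic_block m (fourier_multiplier \<sigma> f))
      \<le> ennreal (sqrt 2 * C * 2 powr (real m * (1/2 - \<rho>)) * L)"
    using assms \<open>0 \<le> L\<close> by (intro Lp_norm_le_of_bounded) auto
  also have "\<dots> = ennreal (sqrt 2 * C * 2 powr (real m * (1/2 - \<rho>))) * ennreal L"
    using assms \<open>0 \<le> L\<close> by (simp add: ennreal_mult)
  also have "\<dots> \<le> ennreal (sqrt 2 * C * 2 powr (real m * (1/2 - \<rho>))) * Lp_norm \<infinity> (dyadic_block m f)"
    unfolding L_def by (intro mult_left_mono l2_dyadic_coeffs_le_Linfinity) auto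
  finally show ?thesis .
qed

lemma Lp_norm_dyadic_block_le_besov:
  "Lp_norm p (dyadic_block m f) \<le> ennreal (2 powr (- real m * s)) * besov_norm s p \<infinity> f"
proof -
  have "Lp_norm p (dyadic_block m f)
      = ennreal (2 powr (- real m * s)) * (ennreal (2 powr (real m * s)) * Lp_norm p (dyadic_block m f))"
    by (simp add: mult.assoc[symmetric] ennreal_mult[symmetric] powr_add[symmetric])
  also have "\<dots> \<le> ennreal (2 powr (- real m * s)) * besov_norm s p \<infinity> f"
    unfolding besov_norm_def by (auto intro!: mult_left_mono SUP_upper)
  finally show ?thesis .
qed

lemma Lp_norm_dyadic_block_multiplier_le_besov:
  assumes "0 \<le> \<rho>" "0 < p" "0 \<le> C"
    and "\<And>\<xi>. \<xi> \<noteq> 0 \<Longrightarrow> cmod (\<sigma> \<xi>) \<le> C * \<bar>of_int \<xi>\<bar> powr (- \<rho>)"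
  shows "Lp_norm p (dyadic_block m (fourier_multiplier \<sigma> f))
    \<le> ennreal (sqrt 2 * C * 2 powr (real m * (1/2 - \<rho> - s))) * besov_norm s \<infinity> \<infinity> f"
proof -
  let ?K = "sqrt 2 * C * 2 powr (real m * (1/2 - \<rho>))"
  have "Lp_norm p (dyadic_block m (fourier_multiplier \<sigma> f))
      \<le> ennreal ?K * Lp_norm \<infinity> (dyadic_block m f)"
    using assms by (rule Lp_norm_dyadic_block_multiplier_le)
  also have "\<dots> \<le> ennreal ?K * (ennreal (2 powr (- real m * s)) * besov_norm s \<infinity> \<infinity> f)"
    by (intro mult_left_mono Lp_norm_dyadic_block_le_besov) auto
  also have "\<dots> = ennreal (?K * 2 powr (- real m * s)) * besov_norm s \<infinity> \<infinity> f"
    using assms by (simp add: ennreal_mult mult.assoc)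
  also have "?K * 2 powr (- real m * s) = sqrt 2 * C * 2 powr (real m * (1/2 - \<rho> - s))"
    by (simp add: powr_add[symmetric] algebra_simps)
  finally show ?thesis .
qed

section \<open>Summation over the blocks\<close>

text \<open>In the two lemmas below, \<open>a\<close> is the growth exponent of the blocks of \<open>g\<close>, and \<open>N\<close> stands for
  the norm of the function from which \<open>g\<close> arises. That norm may be infinite.\<close>
lemma besov_norm_le_of_sup_blocks:
  assumes "\<And>m. Lp_norm p (dyadic_block m g) \<le> ennreal (K * 2 powr (real m * a)) * N"
    and "0 \<le> K" "r + a \<le> 0"
  shows "besov_norm r p \<infinity> g \<le> ennreal K * N"
proof -
  have "ennreal (2 powr (real m * r)) * Lp_norm p (dyadic_block m g) \<le> ennreal K * N" for m
  proof -
    have "ennreal (2 powr (real m * r)) * Lp_norm p (dyadic_block m g)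
        \<le> ennreal (2 powr (real m * r)) * (ennreal (K * 2 powr (real m * a)) * N)"
      by (intro mult_left_mono assms) auto
    also have "\<dots> = ennreal (K * 2 powr (real m * (r + a))) * N"
    proof -
      have *: "K * 2 powr (real m * (r + a)) = 2 powr (real m * r) * (K * 2 powr (real m * a))"
        by (simp add: powr_add distrib_left)
      show ?thesis
        unfolding * using \<open>0 \<le> K\<close> by (simp add: ennreal_mult mult.assoc)
    qed
    also have "\<dots> \<le> ennreal K * N"
    proof -
      have "2 powr (real m * (r + a)) \<le> 2 powr (0 :: real)"
        using assms by (intro powr_mono mult_nonneg_nonpos) auto
      then show ?thesis
        using assms by (intro mult_right_mono ennreal_leI) (auto intro: mult_left_le)
    qed
    finally show ?thesis .
  qed
  then show ?thesis
    by (auto simp: besov_norm_def intro: SUP_least)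
qed

text \<open>After weighting, the \<open>q\<close>-th powers of the block norms are dominated by a geometric series of
  ratio \<open>2 powr ((r + a) * q)\<close>. The constant is the \<open>q\<close>-th root of its sum.\<close>
lemma besov_norm_le_of_geometric_blocks:
  assumes blocks: "\<And>m. Lp_norm p (dyadic_block m g) \<le> ennreal (K * 2 powr (real m * a)) * N"
    and "0 < K" "r + a < 0" "0 < q" "q < \<infinity>"
  shows "besov_norm r p q g
    \<le> ennreal (K * (1 / (1 - 2 powr ((r + a) * enn2real q))) powr (1 / enn2real q)) * N"
proof -
  define q' where "q' = enn2real q"
  define \<theta> where "\<theta> = 2 powr ((r + a) * q')"
  have q': "0 < q'"
    using assms by (simp add: q'_def enn2real_positive_iff)
  have \<theta>: "0 < \<theta>" "\<theta> < 1"
    using assms q' by (auto simp: \<theta>_def mult_neg_pos powr_less_one)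
  show ?thesis
    unfolding q'_def[symmetric] \<theta>_def[symmetric]
  proof (cases N)
    case (real n)
    have summand_le: "ennreal (2 powr (real m * r * q')) * ennreal_powr (Lp_norm p (dyadic_block m g)) q'
        \<le> ennreal ((K * n) powr q' * \<theta> ^ m)" for m
    proof -
      have "Lp_norm p (dyadic_block m g) \<le> ennreal (K * 2 powr (real m * a) * n)"
        using blocks[of m] real assms by (simp add: ennreal_mult)
      then have "ennreal_powr (Lp_norm p (dyadic_block m g)) q'
          \<le> ennreal_powr (ennreal (K * 2 powr (real m * a) * n)) q'"
        using q' by (intro ennreal_powr_mono) auto
      also have "\<dots> = ennreal ((K * n) powr q' * 2 powr (real m * a * q'))"
        using real assms by (simp add: powr_mult powr_powr mult_ac)
      finally have "ennreal (2 powr (real m * r * q')) * ennreal_powr (Lp_norm p (dyadic_block m g)) q'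
          \<le> ennreal (2 powr (real m * r * q')) * ennreal ((K * n) powr q' * 2 powr (real m * a * q'))"
        by (intro mult_left_mono) auto
      also have "\<dots> = ennreal ((K * n) powr q' * \<theta> ^ m)"
      proof -
        have "\<theta> ^ m = 2 powr (real m * r * q') * 2 powr (real m * a * q')"
          using \<theta> by (simp add: powr_realpow[symmetric])
            (simp add: \<theta>_def powr_powr powr_add[symmetric] algebra_simps)
        then show ?thesis
          by (simp add: ennreal_mult[symmetric] mult_ac)
      qed
      finally show ?thesis .
    qed
    have "(\<Sum>m. ennreal (2 powr (real m * r * q')) * ennreal_powr (Lp_norm p (dyadic_block m g)) q')
        \<le> (\<Sum>m. ennreal ((K * n) powr q' * \<theta> ^ m))"
      by (intro suminf_le summand_le) auto
    also have "\<dots> = ennreal ((K * n) powr q' * (1 / (1 - \<theta>)))"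
      using \<theta> geometric_sums[of \<theta>]
      by (intro suminf_ennreal_eq sums_mult) auto
    finally have "besov_norm r p q g \<le> ennreal_powr (ennreal ((K * n) powr q' * (1 / (1 - \<theta>)))) (1 / q')"
      using assms q' by (auto simp: besov_norm_def q'_def[symmetric] intro!: ennreal_powr_mono)
    also have "\<dots> = ennreal (K * (1 / (1 - \<theta>)) powr (1 / q')) * N"
      using assms q' \<theta> real
      by (simp add: ennreal_mult[symmetric] powr_mult powr_powr powr_divide mult_ac)
    finally show "besov_norm r p q g \<le> ennreal (K * (1 / (1 - \<theta>)) powr (1 / q')) * N" .
  next
    case top
    \<comment> \<open>The product of zero and infinity is zero, so the constant has to be strictly positive.\<close>
    have "0 < K * (1 / (1 - \<theta>)) powr (1 / q')"
      using assms \<theta> by simp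
    with top show "besov_norm r p q g \<le> ennreal (K * (1 / (1 - \<theta>)) powr (1 / q')) * N"
      using \<open>0 < K\<close> \<theta> by (simp add: ennreal_mult_top)
  qed
qed

theorem theorem3p1:
  fixes \<rho> r s :: real and \<sigma> :: "int \<Rightarrow> complex"
  assumes "0 \<le> \<rho>" and "\<rho> \<le> 1" and "rho_condition \<rho> \<sigma>"
  shows "(\<forall>p q :: ennreal. r + 1/2 - \<rho> < s \<and> s \<le> 1 \<and> 0 < p \<and> 0 < q \<and> q < \<infinity> \<longrightarrow>
            bounded_from_into (besov_norm s \<infinity> \<infinity>) (besov_norm r p q) (fourier_multiplier \<sigma>))
       \<and> (\<forall>p :: ennreal. r + 1/2 - \<rho> \<le> s \<and> s \<le> 1 \<and> 0 < p \<longrightarrow>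
            bounded_from_into (besov_norm s \<infinity> \<infinity>) (besov_norm r p \<infinity>) (fourier_multiplier \<sigma>))"
proof (intro conjI allI impI)
  obtain C where C: "0 < C" "\<And>\<xi>. \<xi> \<noteq> 0 \<Longrightarrow> cmod (\<sigma> \<xi>) \<le> C * \<bar>of_int \<xi>\<bar> powr (- \<rho>)"
    using \<open>rho_condition \<rho> \<sigma>\<close> unfolding rho_condition_def by blast
  define K where "K = sqrt 2 * C"
  have K: "0 < K"
    using C by (simp add: K_def)
  have blocks: "Lp_norm p (dyadic_block m (fourier_multiplier \<sigma> f))
      \<le> ennreal (K * 2 powr (real m * (1/2 - \<rho> - s))) * besov_norm s \<infinity> \<infinity> f"
    if "0 < p" for p m f
    unfolding K_def
    using Lp_norm_dyadic_block_multiplier_le_besov[OF \<open>0 \<le> \<rho>\<close> that] C by auto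
  {
    fix p q :: ennreal
    assume pq: "r + 1/2 - \<rho> < s \<and> s \<le> 1 \<and> 0 < p \<and> 0 < q \<and> q < \<infinity>"
    define \<theta> where "\<theta> = 2 powr ((r + (1/2 - \<rho> - s)) * enn2real q)"
    have "\<theta> < 1"
      unfolding \<theta>_def using pq by (intro powr_less_one mult_neg_pos) (auto simp: enn2real_positive_iff)
    then have "0 < K * (1 / (1 - \<theta>)) powr (1 / enn2real q)"
      using K by simp
    moreover have "besov_norm r p q (fourier_multiplier \<sigma> f)
        \<le> ennreal (K * (1 / (1 - \<theta>)) powr (1 / enn2real q)) * besov_norm s \<infinity> \<infinity> f" for f
      unfolding \<theta>_def using pq K by (intro besov_norm_le_of_geometric_blocks blocks) auto
    ultimately show "bounded_from_into (besov_norm s \<infinity> \<infinity>) (besov_norm r p q) (fourier_multiplier \<sigma>)"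
      unfolding bounded_from_into_def by blast
  next
    fix p :: ennreal
    assume p: "r + 1/2 - \<rho> \<le> s \<and> s \<le> 1 \<and> 0 < p"
    have "besov_norm r p \<infinity> (fourier_multiplier \<sigma> f) \<le> ennreal K * besov_norm s \<infinity> \<infinity> f" for f
      using p K by (intro besov_norm_le_of_sup_blocks[OF blocks]) auto
    then show "bounded_from_into (besov_norm s \<infinity> \<infinity>) (besov_norm r p \<infinity>) (fourier_multiplier \<sigma>)"
      unfolding bounded_from_into_def using K by blast
  }
qed

end
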